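(* Let $\Pi\in\mathbb{C}^{n\times n}$ be the smallest nonnegative self-adjoint solution of the control algebraic Riccati equation $$A_d^*\Pi A_d-\Pi+C_d^*C_d=V^*P^{-1}V,\qquad P:=I+D_d^*D_d+B_d^*\Pi B_d,\quad V:=D_d^*C_d+B_d^*\Pi A_d,$$ and let $F_d:=-P^{-1}V$. Let $\tau:=\int_0^1\lambda_0(\eta)^{-1}\,\mathrm{d}\eta$. Then the function $$\boldsymbol{\chi}(s)=P^{\frac12}\left[I-F_d\,(e^{s\tau}I-A_d)^{-1}B_d\right]$$ satisfies formally $$\boldsymbol{\chi}(-\overline{s})^*\boldsymbol{\chi}(s)=I+\hat{\mathbf{G}}(-\overline{s})^*\hat{\mathbf{G}}(s),$$ i.e. this identity holds for every $s\in\mathbb{C}$ for which both $e^{s\tau}I-A_d$ and $e^{-\overline{s}\tau}I-A_d$ are invertible, where $$\hat{\mathbf{G}}(s)=C_d(e^{s\tau}I-A_d)^{-1}B_d+D_d .$$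
   Context: Let $n,p,m$ be positive integers with $p\le n$, and let $\lambda_0:[0,1]\to\mathbb{R}$ be a bounded measurable function with $\lambda_0(\cdot)\ge\epsilon>0$ for some constant $\epsilon$. Let $K,L\in\mathbb{C}^{n\times n}$ and $K_y,L_y\in\mathbb{C}^{m\times n}$ be matrices with $K$ invertible. Set $$A_d:=-K^{-1}L,\quad B_d:=-K^{-1}\left[\begin{smallmatrix}0\\ I\end{smallmatrix}\right],\quad C_d:=K_yK^{-1}L-L_y,\quad D_d:=K_yK^{-1}\left[\begin{smallmatrix}0\\ I\end{smallmatrix}\right],$$ where $\left[\begin{smallmatrix}0\\ I\end{smallmatrix}\right]\in\mathbb{C}^{n\times p}$ has the $p\times p$ identity as its last $p$ rows. The function $\hat{\mathbf{G}}$ is the transfer function of the boundary controlled and observed PDE $\partial_t z=-\partial_\zeta(\lambda_0z)$ on $[0,1]$ (with $z(\zeta,t)\in\mathbb{C}^n$, input $u(t)\in\mathbb{C}^p$, output $y(t)\in\mathbb{C}^m$), $\left[\begin{smallmatrix}0\\ I\end{smallmatrix}\right]u(t)=-K\lambda_0(0)z(0,t)-L\lambda_0(1)z(1,t)$, $y(t)=-K_y\lambda_0(0)z(0,t)-L_y\lambda_0(1)z(1,t)$. It is given by the explicit formula in the claim. "Nonnegative" means positive semidefinite Hermitian; "smallest" is with respect to the usual order of Hermitian matrices among nonnegative solutions. $M^*$ denotes the conjugate transpose, and $\boldsymbol{\chi}(-\overline{s})^*$ is the conjugate transpose of the matrix $\boldsymbol{\chi}(-\overline{s})$. *)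

theory Defs
  imports
    "HOL-Analysis.Lebesgue_Measure"
    "HOL-Analysis.Set_Integral"
    "Jordan_Normal_Form.Schur_Decomposition"
    "Jordan_Normal_Form.Gauss_Jordan_Elimination"
begin

text \<open>
  Matrices have the sizes recorded in their carriers \<^const>\<open>carrier_mat\<close>; the conjugate transpose
  is \<^const>\<open>mat_adjoint\<close>. The order on \<^typ>\<open>complex\<close> used below is the one for
  which \<open>0 \<le> z\<close> means that \<open>z\<close> is real and nonnegative.
\<close>

definition minv :: "complex mat \<Rightarrow> complex mat" where
  \<comment> \<open>meaningful only when \<^term>\<open>invertible_mat A\<close>\<close>
  "minv A = the (mat_inverse A)"

definition nonneg_mat :: "nat \<Rightarrow> complex mat \<Rightarrow> bool" where
  "nonneg_mat n A \<longleftrightarrow>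
     A \<in> carrier_mat n n \<and> mat_adjoint A = A \<and>
     (\<forall>v \<in> carrier_vec n. 0 \<le> (A *\<^sub>v v) \<bullet>c v)"

definition sqrt_mat :: "complex mat \<Rightarrow> complex mat" where
  \<comment> \<open>A positive semidefinite matrix has exactly one positive semidefinite square root.\<close>
  "sqrt_mat A = (SOME R. nonneg_mat (dim_row A) R \<and> R * R = A)"

definition input_embedding :: "nat \<Rightarrow> nat \<Rightarrow> complex mat" where
  "input_embedding n p = 0\<^sub>m (n - p) p @\<^sub>r 1\<^sub>m p"

lemma input_embedding_entries:
  "p \<le> n \<Longrightarrow> input_embedding n p = mat n p (\<lambda>(i, j). if i = n - p + j then 1 else 0)"
  unfolding input_embedding_def append_rows_def
  by (rule eq_matI) (auto simp: four_block_mat_def Let_def)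

lemma mat_adjoint_entries:
  "A \<in> carrier_mat n k \<Longrightarrow> mat_adjoint A = mat k n (\<lambda>(i, j). cnj (A $$ (j, i)))"
  unfolding mat_adjoint_def by (rule eq_matI) (auto simp: mat_of_rows_def)

lemma nonneg_complex_iff: "0 \<le> (z :: complex) \<longleftrightarrow> Im z = 0 \<and> 0 \<le> Re z"
  by (auto simp: less_eq_complex_def)

lemma minv_correct:
  assumes "A \<in> carrier_mat n n" "invertible_mat A"
  shows "minv A \<in> carrier_mat n n" "A * minv A = 1\<^sub>m n" "minv A * A = 1\<^sub>m n"
proof -
  obtain B where B: "A * B = 1\<^sub>m n" "B * A = 1\<^sub>m (dim_row B)"
    using assms by (auto simp: invertible_mat_def inverts_mat_def)
  have "dim_col B = n" using arg_cong[OF B(1), of dim_col] by simp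
  moreover have "dim_row B = n" using arg_cong[OF B(2), of dim_col] assms by simp
  ultimately have "A \<in> Units (ring_mat TYPE(complex) n ())"
    using assms B by (auto simp: Units_def ring_mat_def)
  then obtain C where "mat_inverse A = Some C"
    using mat_inverse(1)[OF assms(1), of "()"] by (cases "mat_inverse A") auto
  then show "minv A \<in> carrier_mat n n" "A * minv A = 1\<^sub>m n" "minv A * A = 1\<^sub>m n"
    using mat_inverse(2)[OF assms(1)] by (auto simp: minv_def)
qed

definition riccati_P :: "complex mat \<Rightarrow> complex mat \<Rightarrow> complex mat \<Rightarrow> complex mat" where
  "riccati_P B D X = 1\<^sub>m (dim_col D) + mat_adjoint D * D + mat_adjoint B * X * B"

definition riccati_V ::
  "complex mat \<Rightarrow> complex mat \<Rightarrow> complex mat \<Rightarrow> complex mat \<Rightarrow> complex mat \<Rightarrow> complex mat" where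
  "riccati_V A B C D X = mat_adjoint D * C + mat_adjoint B * X * A"

text \<open>For nonnegative \<open>X\<close> the matrix \<^term>\<open>riccati_P B D X\<close> dominates the identity,
  so the inverse in the Riccati equation exists.\<close>

definition nonneg_riccati_solution ::
  "nat \<Rightarrow> complex mat \<Rightarrow> complex mat \<Rightarrow> complex mat \<Rightarrow> complex mat \<Rightarrow> complex mat \<Rightarrow> bool" where
  "nonneg_riccati_solution n A B C D X \<longleftrightarrow>
     nonneg_mat n X \<and>
     mat_adjoint A * X * A - X + mat_adjoint C * C =
       mat_adjoint (riccati_V A B C D X) * minv (riccati_P B D X) * riccati_V A B C D X"

definition smallest_nonneg_riccati_solution ::
  "nat \<Rightarrow> complex mat \<Rightarrow> complex mat \<Rightarrow> complex mat \<Rightarrow> complex mat \<Rightarrow> complex mat \<Rightarrow> bool" where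
  "smallest_nonneg_riccati_solution n A B C D X \<longleftrightarrow>
     nonneg_riccati_solution n A B C D X \<and>
     (\<forall>Y. nonneg_riccati_solution n A B C D Y \<longrightarrow> nonneg_mat n (Y - X))"

end

theory Submission
  imports
    Defs
    "HOL-Analysis.Complex_Transcendental"
    "Jordan_Normal_Form.Spectral_Radius"
begin

text \<open>
  Let \<open>z\<close> and \<open>w\<close> be the values of the exponential at \<open>s\<close> and at minus its conjugate, so that
  \<open>w\<^sup>* z = 1\<close>, and let \<open>Y\<close>, \<open>Z\<close> solve \<open>(z I - A) Y = B\<close>, \<open>(w I - A) Z = B\<close>. Expanding with the
  Riccati equation gives
  \<open>(I - F Z)\<^sup>* P (I - F Y) = I + (C Z + D)\<^sup>* (C Y + D) + (A Z + B)\<^sup>* X (A Y + B) - Z\<^sup>* X Y\<close>.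
  Since \<open>A Y + B = z Y\<close> and \<open>A Z + B = w Z\<close>, the last two terms cancel. Nonnegativity of
  \<open>X\<close> makes \<open>P\<close> invertible with a self-adjoint square root.
\<close>

subsection \<open>Adjoint matrices\<close>

lemma dim_mat_adjoint [simp]:
  "dim_row (mat_adjoint A) = dim_col A" "dim_col (mat_adjoint A) = dim_row A"
  unfolding mat_adjoint_def by auto

lemma mat_adjoint_carrier [simp]:
  "A \<in> carrier_mat n k \<Longrightarrow> mat_adjoint A \<in> carrier_mat k n"
  by (metis carrier_matD carrier_matI dim_mat_adjoint)

lemma index_mat_adjoint [simp]:
  fixes A :: "complex mat"
  assumes "i < dim_col A" "j < dim_row A"
  shows "mat_adjoint A $$ (i, j) = cnj (A $$ (j, i))"
  using assms mat_adjoint_entries[of A "dim_row A" "dim_col A"] by simp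

lemma mat_adjoint_adjoint [simp]: "mat_adjoint (mat_adjoint A) = (A :: complex mat)"
  by (rule eq_matI) auto

lemma mat_adjoint_mult:
  fixes A B :: "complex mat"
  assumes "dim_col A = dim_row B"
  shows "mat_adjoint (A * B) = mat_adjoint B * mat_adjoint A"
  using assms by (intro eq_matI) (auto simp: scalar_prod_def mult.commute)

lemma mat_adjoint_add:
  fixes A B :: "complex mat"
  assumes "dim_row A = dim_row B" "dim_col A = dim_col B"
  shows "mat_adjoint (A + B) = mat_adjoint A + mat_adjoint B"
  using assms by (intro eq_matI) auto

lemma mat_adjoint_smult: "mat_adjoint (c \<cdot>\<^sub>m A) = cnj c \<cdot>\<^sub>m mat_adjoint (A :: complex mat)"
  by (rule eq_matI) auto

lemma mat_adjoint_one [simp]: "mat_adjoint (1\<^sub>m n) = (1\<^sub>m n :: complex mat)"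
  by (rule eq_matI) auto

lemma index_adjoint_mult:
  fixes A B :: "complex mat"
  assumes "dim_row A = dim_row B" "i < dim_col A" "j < dim_col B"
  shows "(mat_adjoint A * B) $$ (i, j) = col B j \<bullet>c col A i"
  using assms by (auto simp: scalar_prod_def mult.commute)

text \<open>Exchanging the two finite sums moves the matrix to the other side of the scalar product;
  quadratic forms are transported along congruences this way.\<close>

lemma cscalar_prod_mult_mat_vec:
  fixes A :: "complex mat"
  assumes "A \<in> carrier_mat n k" "v \<in> carrier_vec k" "w \<in> carrier_vec n"
  shows "(A *\<^sub>v v) \<bullet>c w = v \<bullet>c (mat_adjoint A *\<^sub>v w)"
proof -
  have "(A *\<^sub>v v) \<bullet>c w = (\<Sum>i<n. \<Sum>j<k. A $$ (i, j) * v $ j * cnj (w $ i))"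
    using assms by (auto simp: scalar_prod_def sum_distrib_right atLeast0LessThan)
  also have "\<dots> = (\<Sum>j<k. \<Sum>i<n. A $$ (i, j) * v $ j * cnj (w $ i))"
    by (rule sum.swap)
  also have "\<dots> = v \<bullet>c (mat_adjoint A *\<^sub>v w)"
    using assms by (auto simp: scalar_prod_def sum_distrib_left atLeast0LessThan mult_ac)
  finally show ?thesis .
qed

text \<open>The hypotheses are equations between dimensions instead of carrier memberships, so no
  size occurs that is absent from the conclusion and the simplifier can discharge them. With the
  distributive laws below, expressions normalise to sums of right-nested products.\<close>

lemma mat_assoc:
  "dim_col A = dim_row B \<Longrightarrow> dim_col B = dim_row C \<Longrightarrow> A * B * C = A * (B * C :: complex mat)"
  by (rule assoc_mult_mat[of A "dim_row A" "dim_col A" B "dim_col B" C "dim_col C"]) auto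

lemma mat_distrib_left:
  "dim_col A = dim_row B \<Longrightarrow> dim_row B = dim_row C \<Longrightarrow> dim_col B = dim_col C \<Longrightarrow>
    A * (B + C) = A * B + A * (C :: complex mat)"
  by (rule mult_add_distrib_mat[of A "dim_row A" "dim_col A" B "dim_col B" C]) auto

lemma mat_distrib_right:
  "dim_row A = dim_row B \<Longrightarrow> dim_col A = dim_col B \<Longrightarrow> dim_col B = dim_row C \<Longrightarrow>
    (A + B) * C = A * C + B * (C :: complex mat)"
  by (rule add_mult_distrib_mat[of A "dim_row A" "dim_col A" B C "dim_col C"]) auto

lemma mat_diff_distrib_right:
  "dim_row A = dim_row B \<Longrightarrow> dim_col A = dim_col B \<Longrightarrow> dim_col B = dim_row C \<Longrightarrow>
    (A - B) * C = A * C - B * (C :: complex mat)"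
  by (rule minus_mult_distrib_mat[of A "dim_row A" "dim_col A" B C "dim_col C"]) auto

lemma mat_diff_distrib_left:
  "dim_col A = dim_row B \<Longrightarrow> dim_row B = dim_row C \<Longrightarrow> dim_col B = dim_col C \<Longrightarrow>
    A * (B - C) = A * B - A * (C :: complex mat)"
  by (rule mult_minus_distrib_mat[of A "dim_row A" "dim_col A" B "dim_col B" C]) auto

lemmas mat_dim_simps = mat_assoc mat_distrib_left mat_distrib_right mat_adjoint_mult mat_adjoint_add

subsection \<open>Nonnegative matrices\<close>

lemma nonneg_matI:
  assumes "A \<in> carrier_mat n n" "mat_adjoint A = A"
    and "\<And>v. v \<in> carrier_vec n \<Longrightarrow> 0 \<le> (A *\<^sub>v v) \<bullet>c v"
  shows "nonneg_mat n A"
  using assms unfolding nonneg_mat_def by blast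

lemma nonneg_matD:
  assumes "nonneg_mat n A"
  shows "A \<in> carrier_mat n n" "mat_adjoint A = A"
    and "v \<in> carrier_vec n \<Longrightarrow> 0 \<le> (A *\<^sub>v v) \<bullet>c v"
  using assms unfolding nonneg_mat_def by blast+

text \<open>The quadratic form of the congruent matrix at \<open>v\<close> is that of
  \<open>A\<close> at the image of \<open>v\<close> under \<open>M\<close>.\<close>

lemma nonneg_mat_congruence:
  assumes A: "nonneg_mat n A" and M: "M \<in> carrier_mat n k"
  shows "nonneg_mat k (mat_adjoint M * A * M)"
proof (rule nonneg_matI)
  note c = nonneg_matD(1)[OF A]
  show "mat_adjoint M * A * M \<in> carrier_mat k k" using c M by auto
  show "mat_adjoint (mat_adjoint M * A * M) = mat_adjoint M * A * M"
    using c M nonneg_matD(2)[OF A]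
    by (simp add: mat_adjoint_mult assoc_mult_mat[OF mat_adjoint_carrier[OF M] c M])
  fix v :: "complex vec" assume v: "v \<in> carrier_vec k"
  have "mat_adjoint M * A * M *\<^sub>v v = mat_adjoint M *\<^sub>v (A *\<^sub>v (M *\<^sub>v v))"
    using c M v assoc_mult_mat_vec[of "mat_adjoint M * A" k n M k v]
      assoc_mult_mat_vec[of "mat_adjoint M" k n A n "M *\<^sub>v v"]
    by (metis mat_adjoint_carrier mult_carrier_mat mult_mat_vec_carrier)
  then have "(mat_adjoint M * A * M *\<^sub>v v) \<bullet>c v = (A *\<^sub>v (M *\<^sub>v v)) \<bullet>c (M *\<^sub>v v)"
    using c M v cscalar_prod_mult_mat_vec[of "mat_adjoint M" k n "A *\<^sub>v (M *\<^sub>v v)" v] by simp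
  then show "0 \<le> (mat_adjoint M * A * M *\<^sub>v v) \<bullet>c v"
    using nonneg_matD(3)[OF A, of "M *\<^sub>v v"] M v by simp
qed

lemma nonneg_mat_add:
  assumes A: "nonneg_mat n A" and B: "nonneg_mat n B"
  shows "nonneg_mat n (A + B)"
proof (rule nonneg_matI)
  note c = nonneg_matD(1)[OF A] nonneg_matD(1)[OF B]
  show "A + B \<in> carrier_mat n n" using c by auto
  show "mat_adjoint (A + B) = A + B"
    using c nonneg_matD(2)[OF A] nonneg_matD(2)[OF B] by (simp add: mat_adjoint_add)
  fix v :: "complex vec" assume v: "v \<in> carrier_vec n"
  have "((A + B) *\<^sub>v v) \<bullet>c v = (A *\<^sub>v v) \<bullet>c v + (B *\<^sub>v v) \<bullet>c v"
    using c v by (simp add: add_mult_distrib_mat_vec[of _ n n] add_scalar_prod_distrib[of _ n])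
  then show "0 \<le> ((A + B) *\<^sub>v v) \<bullet>c v"
    using nonneg_matD(3)[OF A v] nonneg_matD(3)[OF B v] by simp
qed

lemma nonneg_mat_one [simp]: "nonneg_mat n (1\<^sub>m n)"
  by (rule nonneg_matI) auto

lemma nonneg_mat_adjoint_mult:
  assumes "D \<in> carrier_mat m p"
  shows "nonneg_mat p (mat_adjoint D * D)"
  using nonneg_mat_congruence[OF nonneg_mat_one assms] assms by simp

text \<open>Splitting a vector along the blocks makes the quadratic form a sum of two nonnegative
  ones.\<close>

lemma nonneg_mat_block:
  assumes A: "nonneg_mat k A" and D: "nonneg_mat l D"
  shows "nonneg_mat (k + l) (four_block_mat A (0\<^sub>m k l) (0\<^sub>m l k) D)" (is "nonneg_mat _ ?M")
proof (rule nonneg_matI)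
  note c = nonneg_matD(1)[OF A] nonneg_matD(1)[OF D]
  show M: "?M \<in> carrier_mat (k + l) (k + l)" using c by auto
  have "cnj (A $$ (i, j)) = A $$ (j, i)" if "i < k" "j < k" for i j
    using index_mat_adjoint[of j A i] nonneg_matD(2)[OF A] c that by simp
  moreover have "cnj (D $$ (i, j)) = D $$ (j, i)" if "i < l" "j < l" for i j
    using index_mat_adjoint[of j D i] nonneg_matD(2)[OF D] c that by simp
  ultimately show "mat_adjoint ?M = ?M"
    using c by (intro eq_matI) auto
  fix v :: "complex vec" assume v: "v \<in> carrier_vec (k + l)"
  define a d where "a = vec_first v k" and "d = vec_last v l"
  have ad: "a \<in> carrier_vec k" "d \<in> carrier_vec l" and v_eq: "v = a @\<^sub>v d"
    using v unfolding a_def d_def by auto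
  have "conjugate v = conjugate a @\<^sub>v conjugate d"
    unfolding v_eq using ad by (intro eq_vecI) auto
  then have "(?M *\<^sub>v v) \<bullet>c v = (A *\<^sub>v a @\<^sub>v D *\<^sub>v d) \<bullet> (conjugate a @\<^sub>v conjugate d)"
    using mult_mat_vec_split[OF c ad] v_eq by simp
  also have "\<dots> = (A *\<^sub>v a) \<bullet>c a + (D *\<^sub>v d) \<bullet>c d"
    using c ad by (intro scalar_prod_append[where ?n1.0 = k and ?n2.0 = l]) auto
  finally show "0 \<le> (?M *\<^sub>v v) \<bullet>c v"
    using nonneg_matD(3)[OF A ad(1)] nonneg_matD(3)[OF D ad(2)] by simp
qed

section \<open>Orthonormal bases and square roots\<close>

text \<open>Complete \<open>v\<close> to a basis, orthogonalise by Gram-Schmidt and normalise. The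
  scalar \<open>c\<close> is the normalising factor of \<open>v\<close>.\<close>

lemma orthonormal_completion:
  fixes v :: "complex vec"
  assumes v: "v \<in> carrier_vec n" and v0: "v \<noteq> 0\<^sub>v n"
  obtains U c where "U \<in> carrier_mat n n" "mat_adjoint U * U = 1\<^sub>m n" "col U 0 = c \<cdot>\<^sub>v v"
proof -
  interpret cof_vec_space n "TYPE(complex)" .
  define b where "b = basis_completion v"
  define ws where "ws = gram_schmidt n b"
  note bc = basis_completion[OF v v0, folded b_def]
  have n: "0 < n" using v v0 by (cases n) auto
  obtain vs where bv: "b = v # vs" using bc(6,7) n by (cases b) auto
  have ws: "set ws \<subseteq> carrier_vec n" "corthogonal ws" "length ws = n"
    using gram_schmidt_result[OF bc(2,4,5) ws_def] bc(6) by auto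
  \<comment> \<open>Gram-Schmidt leaves the head of the list unchanged.\<close>
  have hd: "ws ! 0 = v"
    using gram_schmidt_hd[OF v, of vs, folded bv ws_def] ws(3) n by (cases ws) auto
  \<comment> \<open>The reciprocal of the norm, embedded in the complex numbers. Being real, it is
    unaffected by conjugation.\<close>
  define f where "f w = complex_of_real (1 / sqrt (Re (w \<bullet>c w)))" for w :: "complex vec"
  define U where "U = mat_of_cols n (map (\<lambda>w. f w \<cdot>\<^sub>v w) ws)"
  have U: "U \<in> carrier_mat n n" using ws(3) mat_of_cols_carrier(1) unfolding U_def by force
  have wsc: "ws ! i \<in> carrier_vec n" if "i < n" for i using ws(1,3) that by auto
  have col: "col U i = f (ws ! i) \<cdot>\<^sub>v ws ! i" if "i < n" for i
    using that ws(3) wsc[OF that] unfolding U_def by (subst col_mat_of_cols) auto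
  have "mat_adjoint U * U = 1\<^sub>m n"
  proof (rule eq_matI)
    fix i j assume ij: "i < dim_row (1\<^sub>m n :: complex mat)" "j < dim_col (1\<^sub>m n :: complex mat)"
    let ?u = "ws ! i" and ?w = "ws ! j"
    have "(mat_adjoint U * U) $$ (i, j) = (f ?w \<cdot>\<^sub>v ?w) \<bullet>c (f ?u \<cdot>\<^sub>v ?u)"
      using ij U by (simp add: index_adjoint_mult col del: index_mult_mat)
    also have "\<dots> = f ?w * f ?u * (?w \<bullet>c ?u)"
      using ij wsc[of i] wsc[of j] by (simp add: f_def conjugate_smult_vec)
    also have "\<dots> = 1\<^sub>m n $$ (i, j)"
    proof (cases "i = j")
      case True
      \<comment> \<open>The predicate \<open>corthogonal\<close> also excludes a vanishing product
        of a member with itself, so the squared norm is a positive real \<open>r\<close> and the two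
        factors \<open>1 / sqrt r\<close> cancel it.\<close>
      have "?u \<bullet>c ?u \<noteq> 0" using corthogonalD[OF ws(2), of i i] ws(3) ij by simp
      moreover have "0 \<le> ?u \<bullet>c ?u" by (rule conjugate_square_ge_0_vec)
      ultimately obtain r where "?u \<bullet>c ?u = complex_of_real r" "0 < r"
        by (metis complex_is_Real_iff less_eq_complex_def of_real_eq_0_iff of_real_Re
            order_le_less zero_complex.simps)
      then show ?thesis
        using True ij by (simp add: f_def flip: of_real_mult)
    next
      case False
      then show ?thesis using corthogonalD[OF ws(2), of j i] ws(3) ij by simp
    qed
    finally show "(mat_adjoint U * U) $$ (i, j) = 1\<^sub>m n $$ (i, j)" .
  qed (use U in auto)
  then show ?thesis using that U col[OF n] hd by simp
qed

lemma nonneg_mat_single: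
  assumes "0 \<le> r"
  shows "nonneg_mat 1 (mat 1 1 (\<lambda>_. r))"
proof (rule nonneg_matI)
  show "mat_adjoint (mat 1 1 (\<lambda>_. r)) = mat 1 1 (\<lambda>_. r)"
    using assms by (intro eq_matI) (auto simp: nonneg_complex_iff complex_eq_iff)
  fix v :: "complex vec" assume v: "v \<in> carrier_vec 1"
  then have "(mat 1 1 (\<lambda>_. r) *\<^sub>v v) \<bullet>c v = r * (v $ 0 * cnj (v $ 0))"
    by (auto simp: scalar_prod_def)
  also have "0 \<le> \<dots>"
    using mult_nonneg_nonneg[OF assms conjugate_square_positive[of "v $ 0"]] by simp
  finally show "0 \<le> (mat 1 1 (\<lambda>_. r) *\<^sub>v v) \<bullet>c v" .
qed simp

lemma nonneg_complex_square_root: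
  assumes "0 \<le> (z :: complex)"
  obtains r where "0 \<le> r" "r * r = z"
proof
  show "0 \<le> complex_of_real (sqrt (Re z))" using assms by (simp add: nonneg_complex_iff)
  show "complex_of_real (sqrt (Re z)) * complex_of_real (sqrt (Re z)) = z"
    using assms by (simp add: nonneg_complex_iff complex_eq_iff)
qed

lemma mult_unit_vec_cscalar_prod:
  fixes A :: "complex mat"
  assumes "A \<in> carrier_mat n k" "i < n" "j < k"
  shows "(A *\<^sub>v unit_vec k j) \<bullet>c unit_vec n i = A $$ (i, j)"
proof -
  have "conjugate (unit_vec n i :: complex vec) = unit_vec n i"
    by (intro eq_vecI) (auto simp: unit_vec_def)
  then show ?thesis using assms by simp
qed

text \<open>In an orthonormal basis starting with an eigenvector, the first column of the matrix is
  \<open>e\<close> followed by zeros, and self-adjointness clears the first row as well. The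
  remaining block is a compression and hence nonnegative.\<close>

lemma nonneg_mat_eigenvector_deflation:
  assumes A: "nonneg_mat (Suc k) A"
  obtains U e B where "U \<in> carrier_mat (Suc k) (Suc k)" "mat_adjoint U * U = 1\<^sub>m (Suc k)"
    "0 \<le> e" "nonneg_mat k B"
    "mat_adjoint U * A * U = four_block_mat (mat 1 1 (\<lambda>_. e)) (0\<^sub>m 1 k) (0\<^sub>m k 1) B"
proof -
  note cA = nonneg_matD(1)[OF A]
  \<comment> \<open>A complex matrix of positive size has an eigenvalue.\<close>
  obtain e where "eigenvalue A e"
    using spectrum_non_empty[OF cA] by (auto simp: spectrum_def)
  then obtain v where v: "v \<in> carrier_vec (Suc k)" "v \<noteq> 0\<^sub>v (Suc k)" "A *\<^sub>v v = e \<cdot>\<^sub>v v"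
    using cA by (auto simp: eigenvalue_def eigenvector_def)
  obtain U c where U: "U \<in> carrier_mat (Suc k) (Suc k)" and UU: "mat_adjoint U * U = 1\<^sub>m (Suc k)"
    and col0: "col U 0 = c \<cdot>\<^sub>v v"
    using orthonormal_completion[OF v(1,2)] by blast
  define A' where "A' = mat_adjoint U * A * U"
  have A': "nonneg_mat (Suc k) A'" unfolding A'_def by (rule nonneg_mat_congruence[OF A U])
  note cA' = nonneg_matD(1)[OF A']
  have A'_alt: "A' = mat_adjoint U * (A * U)"
    unfolding A'_def by (rule assoc_mult_mat[OF mat_adjoint_carrier[OF U] cA U])
  have ev: "A *\<^sub>v col U 0 = e \<cdot>\<^sub>v col U 0"
    unfolding col0 using v cA by (simp add: mult_mat_vec smult_smult_assoc mult.commute)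
  \<comment> \<open>The entry is \<open>e\<close> times the scalar product of columns
    \<open>0\<close> and \<open>i\<close> of \<open>U\<close>, which orthonormality
    evaluates.\<close>
  have first_col: "A' $$ (i, 0) = (if i = 0 then e else 0)" if "i < Suc k" for i
  proof -
    have "A' $$ (i, 0) = col (A * U) 0 \<bullet>c col U i"
      unfolding A'_alt using that U cA by (intro index_adjoint_mult) auto
    also have "col (A * U) 0 = e \<cdot>\<^sub>v col U 0"
      by (simp only: col_mult2[OF cA U zero_less_Suc] ev)
    also have "(e \<cdot>\<^sub>v col U 0) \<bullet>c col U i = e * (col U 0 \<bullet>c col U i)"
      using U that by simp
    also have "col U 0 \<bullet>c col U i = (mat_adjoint U * U) $$ (i, 0)"
      using U that by (intro index_adjoint_mult[symmetric]) auto
    finally show ?thesis using that unfolding UU by simp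
  qed
  have first_row: "A' $$ (0, j) = 0" if "0 < j" "j < Suc k" for j
    using index_mat_adjoint[of 0 A' j] nonneg_matD(2)[OF A'] cA' first_col[of j] that by simp
  \<comment> \<open>The eigenvalue is the value of the quadratic form at the first unit
    vector.\<close>
  have "(A' *\<^sub>v unit_vec (Suc k) 0) \<bullet>c unit_vec (Suc k) 0 = A' $$ (0, 0)"
    using cA' by (simp add: mult_unit_vec_cscalar_prod)
  then have e: "0 \<le> e"
    using nonneg_matD(3)[OF A', of "unit_vec (Suc k) 0"] first_col[of 0] by simp
  \<comment> \<open>Compression by \<open>E\<close> deletes the first row and the first column.\<close>
  define E where "E = input_embedding (Suc k) k"
  have E: "E \<in> carrier_mat (Suc k) k" unfolding E_def by (simp add: input_embedding_entries)
  have col_E: "col E j = unit_vec (Suc k) (Suc j)" if "j < k" for j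
    unfolding E_def using that by (intro eq_vecI) (auto simp: input_embedding_entries)
  define B where "B = mat_adjoint E * A' * E"
  have B: "nonneg_mat k B" unfolding B_def by (rule nonneg_mat_congruence[OF A' E])
  have index_B: "B $$ (i, j) = A' $$ (Suc i, Suc j)" if "i < k" "j < k" for i j
  proof -
    have "B $$ (i, j) = (mat_adjoint E * (A' * E)) $$ (i, j)"
      unfolding B_def assoc_mult_mat[OF mat_adjoint_carrier[OF E] cA' E] ..
    also have "\<dots> = col (A' * E) j \<bullet>c col E i"
      using that E cA' by (intro index_adjoint_mult) auto
    also have "col (A' * E) j = A' *\<^sub>v unit_vec (Suc k) (Suc j)"
      using that by (simp add: col_mult2[OF cA' E] col_E)
    finally show ?thesis using that cA' by (simp add: col_E mult_unit_vec_cscalar_prod)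
  qed
  have "A' = four_block_mat (mat 1 1 (\<lambda>_. e)) (0\<^sub>m 1 k) (0\<^sub>m k 1) B"
    using cA' nonneg_matD(1)[OF B] first_col first_row
    by (intro eq_matI) (auto simp: index_B)
  then show ?thesis using that U UU e B unfolding A'_def by blast
qed

text \<open>Induction on the size: deflate one eigenvector, take the root of the eigenvalue and of
  the smaller block, and rotate back by \<open>U\<close>.\<close>

lemma nonneg_mat_sqrt_exists:
  "nonneg_mat n A \<Longrightarrow> \<exists>R. nonneg_mat n R \<and> R * R = A"
proof (induction n arbitrary: A)
  case 0
  then have "A * A = A" using nonneg_matD(1)[OF 0] by (intro eq_matI) auto
  then show ?case using 0 by blast
next
  case (Suc k)
  obtain U e B where U: "U \<in> carrier_mat (Suc k) (Suc k)" and UU: "mat_adjoint U * U = 1\<^sub>m (Suc k)"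
    and e: "0 \<le> e" and B: "nonneg_mat k B"
    and block: "mat_adjoint U * A * U = four_block_mat (mat 1 1 (\<lambda>_. e)) (0\<^sub>m 1 k) (0\<^sub>m k 1) B"
    using nonneg_mat_eigenvector_deflation[OF Suc.prems] by blast
  note cA = nonneg_matD(1)[OF Suc.prems]
  obtain r where r: "0 \<le> r" "r * r = e" using nonneg_complex_square_root[OF e] .
  obtain S where S: "nonneg_mat k S" "S * S = B" using Suc.IH[OF B] by blast
  define T where "T = four_block_mat (mat 1 1 (\<lambda>_. r)) (0\<^sub>m 1 k) (0\<^sub>m k 1) S"
  have T: "nonneg_mat (Suc k) T"
    using nonneg_mat_block[OF nonneg_mat_single[OF r(1)] S(1)] unfolding T_def by simp
  note cT = nonneg_matD(1)[OF T] and cS = nonneg_matD(1)[OF S(1)] and cU' = mat_adjoint_carrier[OF U]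
  note dims = carrier_matD[OF cA] carrier_matD[OF cT] carrier_matD[OF U]
  have "mat 1 1 (\<lambda>_. r) * mat 1 1 (\<lambda>_. r) = mat 1 1 (\<lambda>_. e)"
    by (rule eq_matI) (auto simp: scalar_prod_def r(2))
  then have TT: "T * T = mat_adjoint U * A * U"
    unfolding T_def block using cS S(2)
    by (subst mult_four_block_mat[where ?nr1.0 = 1 and ?n1.0 = 1 and ?n2.0 = k and ?nr2.0 = k
          and ?nc1.0 = 1 and ?nc2.0 = k]) auto
  \<comment> \<open>For square matrices a left inverse is also a right inverse.\<close>
  have UU': "U * mat_adjoint U = 1\<^sub>m (Suc k)"
    by (rule mat_mult_left_right_inverse[OF cU' U UU])
  define R where "R = U * T * mat_adjoint U"
  have "nonneg_mat (Suc k) R"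
    using nonneg_mat_congruence[OF T cU'] unfolding R_def by simp
  moreover have "R * R = A"
  proof -
    \<comment> \<open>The inner factor \<open>mat_adjoint U * U\<close> collapses to the identity,
      \<open>T * T\<close> is the rotated \<open>A\<close>, and the outer factors cancel by
      \<open>UU'\<close>.\<close>
    have "R * R = U * (T * ((mat_adjoint U * U) * (T * mat_adjoint U)))"
      unfolding R_def by (simp add: dims mat_assoc)
    also have "\<dots> = U * ((T * T) * mat_adjoint U)"
      unfolding UU by (simp add: dims mat_assoc left_mult_one_mat')
    also have "\<dots> = (U * mat_adjoint U) * A * (U * mat_adjoint U)"
      unfolding TT by (simp add: dims mat_assoc)
    finally show ?thesis unfolding UU' using cA by simp
  qed
  ultimately show ?case by blast
qed

lemma sqrt_mat_nonneg:
  assumes "nonneg_mat n A"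
  shows "nonneg_mat n (sqrt_mat A)" "sqrt_mat A * sqrt_mat A = A"
  using someI_ex[OF nonneg_mat_sqrt_exists[OF assms]] nonneg_matD(1)[OF assms]
  unfolding sqrt_mat_def by auto

text \<open>A nonzero kernel vector \<open>v\<close> would make the squared norm of \<open>v\<close>
  plus a nonnegative number equal to zero.\<close>

lemma invertible_mat_one_plus_nonneg:
  assumes X: "nonneg_mat n X"
  shows "invertible_mat (1\<^sub>m n + X)"
proof -
  note c = nonneg_matD(1)[OF X]
  have cP: "1\<^sub>m n + X \<in> carrier_mat n n" using c by simp
  have "det (1\<^sub>m n + X) \<noteq> 0"
  proof
    assume "det (1\<^sub>m n + X) = 0"
    then obtain v where v: "v \<in> carrier_vec n" "v \<noteq> 0\<^sub>v n" "(1\<^sub>m n + X) *\<^sub>v v = 0\<^sub>v n"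
      using det_0_iff_vec_prod_zero_field[OF cP] by blast
    have "0 = ((1\<^sub>m n + X) *\<^sub>v v) \<bullet>c v" using v by simp
    also have "\<dots> = v \<bullet>c v + (X *\<^sub>v v) \<bullet>c v"
      using c v(1) by (simp add: add_mult_distrib_mat_vec[of _ n n] add_scalar_prod_distrib[of _ n])
    also have "\<dots> > 0"
      using nonneg_matD(3)[OF X v(1)] conjugate_square_greater_0_vec[OF v(1)] v(2)
      by (intro add_pos_nonneg) auto
    finally show False by simp
  qed
  then obtain Y where "Y \<in> carrier_mat n n" "Y * (1\<^sub>m n + X) = 1\<^sub>m n" "(1\<^sub>m n + X) * Y = 1\<^sub>m n"
    using det_non_zero_imp_unit[OF cP, of "()"] by (auto simp: Units_def ring_mat_def)
  then show ?thesis
    using carrier_matD[OF cP] unfolding invertible_mat_def inverts_mat_def square_mat.simps by auto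
qed

subsection \<open>The Riccati factorization\<close>

text \<open>This is the algebraic core, free of exponentials and inverses of resolvents.
  \<open>M\<close> stands for the inverse of \<open>P\<close>, so \<open>M * V\<close> is the
  negative of the feedback \<open>F\<close>; \<open>Y\<close> and \<open>Z\<close> are given by the
  linear equations they solve, and \<open>z\<close>, \<open>w\<close> are linked by
  \<open>wz\<close>.\<close>

lemma riccati_factorization:
  fixes A B C D X M Y Z :: "complex mat" and w z :: complex
  assumes A: "A \<in> carrier_mat n n" and B: "B \<in> carrier_mat n p"
    and C: "C \<in> carrier_mat m n" and D: "D \<in> carrier_mat m p"
    and X: "X \<in> carrier_mat n n" "mat_adjoint X = X"
    and M: "M \<in> carrier_mat p p" "mat_adjoint M = M" "M * riccati_P B D X = 1\<^sub>m p"
      "riccati_P B D X * M = 1\<^sub>m p"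
    and riccati: "mat_adjoint A * X * A - X + mat_adjoint C * C =
      mat_adjoint (riccati_V A B C D X) * M * riccati_V A B C D X"
    and Y: "Y \<in> carrier_mat n p" "z \<cdot>\<^sub>m Y = A * Y + B"
    and Z: "Z \<in> carrier_mat n p" "w \<cdot>\<^sub>m Z = A * Z + B"
    and wz: "cnj w * z = 1"
  shows "mat_adjoint (1\<^sub>m p + M * riccati_V A B C D X * Z) *
      (riccati_P B D X * (1\<^sub>m p + M * riccati_V A B C D X * Y)) =
      1\<^sub>m p + mat_adjoint (C * Z + D) * (C * Y + D)"
proof -
  define P where "P = riccati_P B D X"
  define V where "V = riccati_V A B C D X"
  have P: "P \<in> carrier_mat p p" and V: "V \<in> carrier_mat p n"
    unfolding P_def V_def riccati_P_def riccati_V_def using A B C D X by auto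
  note dims = carrier_matD[OF A] carrier_matD[OF B] carrier_matD[OF C] carrier_matD[OF D]
    carrier_matD[OF X(1)] carrier_matD[OF M(1)] carrier_matD[OF Y(1)] carrier_matD[OF Z(1)]
    carrier_matD[OF P] carrier_matD[OF V]
  \<comment> \<open>Stated with a trailing factor \<open>Q\<close>, so that it still rewrites inside
    right-nested products.\<close>
  have PM: "P * (M * Q) = Q" if "dim_row Q = p" for Q
    using that M(4)[folded P_def] mat_assoc[of P M Q] by (simp add: dims left_mult_one_mat')
  have "mat_adjoint (1\<^sub>m p + M * V * Z) * (P * (1\<^sub>m p + M * V * Y)) =
      P + mat_adjoint Z * mat_adjoint V +
       (V * Y + mat_adjoint Z * (mat_adjoint V * M * V * Y))"
    using M(2) M(3)[folded P_def] by (simp add: dims mat_dim_simps PM)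
  \<comment> \<open>The Riccati equation enters here and replaces the only term that contains
    \<open>M\<close>.\<close>
  also have "mat_adjoint V * M * V * Y = mat_adjoint A * X * A * Y - X * Y + mat_adjoint C * C * Y"
    unfolding V_def riccati[symmetric]
    by (simp add: dims mat_distrib_right mat_diff_distrib_right)
  finally have lhs: "mat_adjoint (1\<^sub>m p + M * V * Z) * (P * (1\<^sub>m p + M * V * Y)) =
      P + mat_adjoint Z * mat_adjoint V + (V * Y +
       (mat_adjoint Z * (mat_adjoint A * X * A * Y) - mat_adjoint Z * (X * Y) +
        mat_adjoint Z * (mat_adjoint C * C * Y)))"
    by (simp only: mat_distrib_left mat_diff_distrib_left dims dim_mat_adjoint index_mult_mat
        index_minus_mat)
  \<comment> \<open>Insert the factor \<open>z * cnj w = 1\<close>, give one scalar to each of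
    \<open>Y\<close> and \<open>Z\<close>, and substitute their defining equations. The expansion
    consists of the terms needed to cancel those with \<open>A\<close> and \<open>B\<close>.\<close>
  have "mat_adjoint Z * (X * Y) = z \<cdot>\<^sub>m (cnj w \<cdot>\<^sub>m (mat_adjoint Z * (X * Y)))"
    using wz[unfolded mult.commute[of _ z]]
    by (intro eq_matI) (auto simp flip: mult.assoc simp del: index_mult_mat(1))
  also have "\<dots> = mat_adjoint (w \<cdot>\<^sub>m Z) * (X * (z \<cdot>\<^sub>m Y))"
    using X(1) Y(1) Z(1) by (simp add: mat_adjoint_smult mult_smult_distrib[of _ n n _ p]
        mult_smult_distrib[of _ p n _ p] mult_smult_assoc_mat[of _ p n _ p])
  also have "\<dots> = mat_adjoint Z * (mat_adjoint A * (X * (A * Y))) + mat_adjoint B * (X * (A * Y)) +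
      (mat_adjoint Z * (mat_adjoint A * (X * B)) + mat_adjoint B * (X * B))"
    unfolding Y(2) Z(2) by (simp add: dims mat_dim_simps)
  finally have XYZ: "mat_adjoint Z * (X * Y) = \<dots>" .
  have "(P + mat_adjoint Z * mat_adjoint V + (V * Y +
       (mat_adjoint Z * (mat_adjoint A * X * A * Y) - mat_adjoint Z * (X * Y) +
        mat_adjoint Z * (mat_adjoint C * C * Y)))) = 1\<^sub>m p + mat_adjoint (C * Z + D) * (C * Y + D)"
    unfolding XYZ P_def V_def riccati_P_def riccati_V_def using X(2)
    \<comment> \<open>After normalisation both sides are sums of the same products. Keeping entries
      of products folded turns the claim into additive cancellation.\<close>
    by (simp add: dims mat_dim_simps, intro eq_matI) (simp_all add: dims del: index_mult_mat(1))
  then show ?thesis using lhs unfolding P_def V_def by simp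
qed

section \<open>The identity for the transfer function\<close>

theorem proposition1:
  fixes n p m :: nat
    and lam :: "real \<Rightarrow> real" and eps tau :: real
    and K L Ky Ly Ad Bd Cd Dd Pi P V Fd :: "complex mat"
    and chi Ghat :: "complex \<Rightarrow> complex mat"
  assumes dims: "0 < n" "0 < p" "0 < m" "p \<le> n"
    and lam_measurable: "lam \<in> borel_measurable (lebesgue_on {0..1})"
    and lam_bounded: "bounded (lam ` {0..1})"
    and lam_lower: "0 < eps" "\<forall>x \<in> {0..1}. eps \<le> lam x"
    and K: "K \<in> carrier_mat n n" "invertible_mat K"
    and L: "L \<in> carrier_mat n n"
    and Ky: "Ky \<in> carrier_mat m n"
    and Ly: "Ly \<in> carrier_mat m n"
    and Ad: "Ad = - (minv K * L)"
    and Bd: "Bd = - (minv K * input_embedding n p)"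
    and Cd: "Cd = Ky * minv K * L - Ly"
    and Dd: "Dd = Ky * minv K * input_embedding n p"
    and Pi: "smallest_nonneg_riccati_solution n Ad Bd Cd Dd Pi"
    and P: "P = riccati_P Bd Dd Pi"
    and V: "V = riccati_V Ad Bd Cd Dd Pi"
    and Fd: "Fd = - (minv P * V)"
    and tau: "tau = (LINT \<eta>:{0..1}|lebesgue. inverse (lam \<eta>))"
    and chi: "\<And>s. chi s = sqrt_mat P *
        (1\<^sub>m p - Fd * minv (exp (s * complex_of_real tau) \<cdot>\<^sub>m 1\<^sub>m n - Ad) * Bd)"
    and Ghat: "\<And>s. Ghat s =
        Cd * minv (exp (s * complex_of_real tau) \<cdot>\<^sub>m 1\<^sub>m n - Ad) * Bd + Dd"
  shows "\<forall>s :: complex.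
      invertible_mat (exp (s * complex_of_real tau) \<cdot>\<^sub>m 1\<^sub>m n - Ad) \<longrightarrow>
      invertible_mat (exp (- cnj s * complex_of_real tau) \<cdot>\<^sub>m 1\<^sub>m n - Ad) \<longrightarrow>
      mat_adjoint (chi (- cnj s)) * chi s =
        1\<^sub>m p + mat_adjoint (Ghat (- cnj s)) * Ghat s"
proof (intro allI impI)
  fix s :: complex
  define z w where "z = exp (s * complex_of_real tau)" and "w = exp (- cnj s * complex_of_real tau)"
  assume "invertible_mat (exp (s * complex_of_real tau) \<cdot>\<^sub>m 1\<^sub>m n - Ad)"
    and "invertible_mat (exp (- cnj s * complex_of_real tau) \<cdot>\<^sub>m 1\<^sub>m n - Ad)"
  then have inv: "invertible_mat (z \<cdot>\<^sub>m 1\<^sub>m n - Ad)" "invertible_mat (w \<cdot>\<^sub>m 1\<^sub>m n - Ad)"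
    unfolding z_def w_def .
  \<comment> \<open>Since \<open>tau\<close> is real, \<open>cnj w\<close> is the exponential of
    \<open>- s * tau\<close>.\<close>
  have wz: "cnj w * z = 1"
    unfolding z_def w_def by (simp add: exp_cnj flip: exp_add)
  have E: "input_embedding n p \<in> carrier_mat n p"
    using dims by (simp add: input_embedding_entries)
  note Kinv = minv_correct(1)[OF K]
  have A: "Ad \<in> carrier_mat n n" and B: "Bd \<in> carrier_mat n p"
    and C: "Cd \<in> carrier_mat m n" and D: "Dd \<in> carrier_mat m p"
    unfolding Ad Bd Cd Dd using Kinv L Ky Ly E by auto
  have X: "nonneg_mat n Pi" and riccati: "mat_adjoint Ad * Pi * Ad - Pi + mat_adjoint Cd * Cd =
      mat_adjoint V * minv P * V"
    using Pi unfolding smallest_nonneg_riccati_solution_def nonneg_riccati_solution_def P V by auto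
  note cX = nonneg_matD(1)[OF X]
  \<comment> \<open>This is \<open>P\<close> minus the identity; its nonnegativity yields both the
    square root and the inverse of \<open>P\<close>.\<close>
  have N: "nonneg_mat p (mat_adjoint Dd * Dd + mat_adjoint Bd * Pi * Bd)"
    by (rule nonneg_mat_add[OF nonneg_mat_adjoint_mult[OF D] nonneg_mat_congruence[OF X B]])
  have P_eq: "P = 1\<^sub>m p + (mat_adjoint Dd * Dd + mat_adjoint Bd * Pi * Bd)"
    unfolding P riccati_P_def carrier_matD(2)[OF D]
    by (rule assoc_add_mat[of _ p p]) (use B D cX in auto)
  have nonneg_P: "nonneg_mat p P"
    unfolding P_eq by (rule nonneg_mat_add[OF nonneg_mat_one N])
  note cP = nonneg_matD(1)[OF nonneg_P] and sqrt_P = sqrt_mat_nonneg[OF nonneg_P]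
  note cS = nonneg_matD(1)[OF sqrt_P(1)]
  have "invertible_mat P" unfolding P_eq by (rule invertible_mat_one_plus_nonneg[OF N])
  note M = minv_correct[OF cP this]
  have cV: "V \<in> carrier_mat p n" unfolding V riccati_V_def using A B C D cX by auto
  \<comment> \<open>Taking adjoints in \<open>P * minv P = 1\<close> shows that the adjoint is again
    a left inverse of the self-adjoint \<open>P\<close>; inverses are unique.\<close>
  have adj_M: "mat_adjoint (minv P) = minv P"
  proof -
    have "mat_adjoint (minv P) * P = 1\<^sub>m p"
      using mat_adjoint_mult[of P "minv P"] nonneg_matD(2)[OF nonneg_P] M cP by simp
    then show ?thesis
      using assoc_mult_mat[OF mat_adjoint_carrier[OF M(1)] cP M(1)] M by simp
  qed
  \<comment> \<open>Multiplying the resolvent out turns it into the linear equation required by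
    \<open>riccati_factorization\<close>; it is used at \<open>z\<close> and at
    \<open>w\<close>.\<close>
  have resolvent: "c \<cdot>\<^sub>m (minv (c \<cdot>\<^sub>m 1\<^sub>m n - Ad) * Bd) = Ad * (minv (c \<cdot>\<^sub>m 1\<^sub>m n - Ad) * Bd) + Bd"
    "minv (c \<cdot>\<^sub>m 1\<^sub>m n - Ad) * Bd \<in> carrier_mat n p"
    if "invertible_mat (c \<cdot>\<^sub>m 1\<^sub>m n - Ad)" for c
  proof -
    have cN: "c \<cdot>\<^sub>m 1\<^sub>m n - Ad \<in> carrier_mat n n" using A by auto
    note R = minv_correct[OF cN that]
    define Y where "Y = minv (c \<cdot>\<^sub>m 1\<^sub>m n - Ad) * Bd"
    show cY: "Y \<in> carrier_mat n p" unfolding Y_def using R(1) B by auto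
    have "Bd = (c \<cdot>\<^sub>m 1\<^sub>m n - Ad) * Y"
      unfolding Y_def using assoc_mult_mat[OF cN R(1) B] R(2) B by simp
    also have "\<dots> = c \<cdot>\<^sub>m Y - Ad * Y"
      using A cY by (simp add: minus_mult_distrib_mat[of _ n n] mult_smult_assoc_mat[of _ n n])
    finally have "Ad * Y + Bd = Ad * Y + (c \<cdot>\<^sub>m Y - Ad * Y)" by simp
    also have "\<dots> = c \<cdot>\<^sub>m Y" using A cY by (intro eq_matI) auto
    finally show "c \<cdot>\<^sub>m Y = Ad * Y + Bd" by simp
  qed
  define Y Z where "Y = minv (z \<cdot>\<^sub>m 1\<^sub>m n - Ad) * Bd" and "Z = minv (w \<cdot>\<^sub>m 1\<^sub>m n - Ad) * Bd"
  note Y = resolvent[OF inv(1), folded Y_def] and Z = resolvent[OF inv(2), folded Z_def]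
  have cR: "minv (c \<cdot>\<^sub>m 1\<^sub>m n - Ad) \<in> carrier_mat n n" if "invertible_mat (c \<cdot>\<^sub>m 1\<^sub>m n - Ad)" for c
    by (rule minv_correct(1)[OF _ that]) (use A in auto)
  have cF: "Fd \<in> carrier_mat p n" unfolding Fd using M(1) cV by auto
  \<comment> \<open>The minus sign in \<open>Fd\<close> turns the difference into the sum that
    appears in the factorization.\<close>
  have Fd_mult: "1\<^sub>m p - Fd * W = 1\<^sub>m p + minv P * V * W" if "W \<in> carrier_mat n p" for W
    unfolding Fd using M(1) cV that by (intro eq_matI) auto
  have "chi s = sqrt_mat P * (1\<^sub>m p + minv P * V * Y)"
    unfolding chi z_def[symmetric] assoc_mult_mat[OF cF cR[OF inv(1)] B] Y_def[symmetric]
    by (simp only: Fd_mult[OF Y(2)])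
  moreover have "chi (- cnj s) = sqrt_mat P * (1\<^sub>m p + minv P * V * Z)"
    unfolding chi w_def[symmetric] assoc_mult_mat[OF cF cR[OF inv(2)] B] Z_def[symmetric]
    by (simp only: Fd_mult[OF Z(2)])
  \<comment> \<open>The root is self-adjoint, so its two copies meet in the middle and multiply to
    \<open>P\<close>.\<close>
  ultimately have "mat_adjoint (chi (- cnj s)) * chi s = mat_adjoint (1\<^sub>m p + minv P * V * Z) *
      ((sqrt_mat P * sqrt_mat P) * (1\<^sub>m p + minv P * V * Y))"
    using cS M(1) cV Y(2) Z(2) nonneg_matD(2)[OF sqrt_P(1)]
    by (simp add: mat_adjoint_mult mat_assoc)
  also have "\<dots> = 1\<^sub>m p + mat_adjoint (Cd * Z + Dd) * (Cd * Y + Dd)"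
    unfolding sqrt_P(2) using riccati_factorization[of Ad n Bd p Cd m Dd Pi "minv P" Y z Z w]
      A B C D cX nonneg_matD(2)[OF X] M adj_M riccati Y Z wz
    unfolding P[symmetric] V[symmetric] by blast
  also have "Cd * Z + Dd = Ghat (- cnj s)"
    unfolding Ghat w_def[symmetric] Z_def assoc_mult_mat[OF C cR[OF inv(2)] B] ..
  also have "Cd * Y + Dd = Ghat s"
    unfolding Ghat z_def[symmetric] Y_def assoc_mult_mat[OF C cR[OF inv(1)] B] ..
  finally show "mat_adjoint (chi (- cnj s)) * chi s =
      1\<^sub>m p + mat_adjoint (Ghat (- cnj s)) * Ghat s" .
qed

end
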